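(* Let $\ell$ be an odd prime, $n$ a positive integer, $t$ an integer, and $\Phi(x)=T_\ell^n(x)-t$. Let $p\neq\ell$ be an odd prime such that $t\equiv\varepsilon\pmod{p^2}$ for some $\varepsilon\in\{2,-2\}$, and write $$\Phi(x)\equiv (x-\varepsilon)\,\phi_1(x)^2\cdots\phi_r(x)^2\pmod p,$$ where $\phi_1,\dots,\phi_r\in\mathbb{Z}[x]$ are monic and their reductions modulo $p$ are irreducible. Let $V=\nu_p(t^2-4)$. Then for each $i$ there exists a monic polynomial $\hat\phi_i\in\mathbb{Z}[x]$ with $\hat\phi_i\equiv\phi_i\pmod p$ such that the principal $\hat\phi_i$-Newton polygon of $\Phi$ (with respect to $p$) consists of the single side with vertices $(0,V)$ and $(2,0)$; in particular $$\operatorname{ind}_{\hat\phi_i}(\Phi)=\left\lfloor\frac{V}{2}\right\rfloor\deg(\hat\phi_i).$$ Moreover, $\operatorname{ind}_{x-\varepsilon}(\Phi)=0$.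
   Context: $T_d(x)$ is the Chebyshev polynomial of the first kind of degree $d$ (the unique monic polynomial with $T_d(z+z^{-1})=z^d+z^{-d}$), and $T_\ell^n$ denotes the $n$-fold composition of $T_\ell$. For a monic $\phi\in\mathbb{Z}[x]$ irreducible modulo $p$, every $f\in\mathbb{Z}[x]$ has a unique $\phi$-adic development $f=\sum_{j\ge0}a_j(x)\phi(x)^j$ with $a_j\in\mathbb{Z}[x]$, $\deg a_j<\deg\phi$; put $u_j=\nu_p(a_j)$, the minimum of the $p$-adic valuations of the coefficients of $a_j$ ($\infty$ if $a_j=0$). The principal $\phi$-Newton polygon $N_\phi(f)$ is the union of the sides of negative slope of the lower convex hull of the points $(j,u_j)$ with $u_j<\infty$. The $\phi$-index $\operatorname{ind}_\phi(f)$ is $\deg\phi$ times the number of points with integer coordinates lying on or below $N_\phi(f)$, strictly above the horizontal axis and strictly to the right of the vertical axis.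
   Formalization: For t = 2 or t = -2 the valuation V of t^2-4 is infinite and (0,V) is not a point, so the Newton polygon claim and the index formula for the lifted factors are stated only when t^2 is not 4; the claim that the index at x-ε is 0 is kept for all t. *)

theory Defs
  imports "HOL-Analysis.Analysis" "HOL-Number_Theory.Cong" "Berlekamp_Zassenhaus.Poly_Mod"
begin

text \<open>The normalised Chebyshev polynomials: \<open>chebyshev d (z + 1/z) = z^d + 1/z^d\<close>. The identity is
  demanded over the complex numbers, which determines the polynomial. For \<open>d = 0\<close> it would force the
  constant 2, which is not monic, so the definite description denotes only for \<open>d > 0\<close>
  (see \<open>chebyshev_ex1\<close>).\<close>

definition is_chebyshev :: "nat \<Rightarrow> int poly \<Rightarrow> bool" where
  "is_chebyshev d q \<longleftrightarrow> lead_coeff q = 1 \<and> degree q = d \<and>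
     (\<forall>z::complex. z \<noteq> 0 \<longrightarrow> poly (of_int_poly q) (z + inverse z) = z ^ d + inverse z ^ d)"

definition chebyshev :: "nat \<Rightarrow> int poly" where
  "chebyshev d = (THE q. is_chebyshev d q)"

definition poly_iterate :: "int poly \<Rightarrow> nat \<Rightarrow> int poly" where
  "poly_iterate q n = (pcompose q ^^ n) [:0, 1:]"

definition padic_val :: "nat \<Rightarrow> int \<Rightarrow> enat" where
  "padic_val p x = (if x = 0 then \<infinity> else enat (multiplicity (int p) x))"

definition poly_val :: "nat \<Rightarrow> int poly \<Rightarrow> enat" where
  "poly_val p a = (INF i. padic_val p (coeff a i))"

definition is_adic_development :: "int poly \<Rightarrow> int poly \<Rightarrow> (nat \<Rightarrow> int poly) \<Rightarrow> bool" where
  "is_adic_development \<phi> f a \<longleftrightarrow>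
     finite {j. a j \<noteq> 0} \<and> (\<forall>j. degree (a j) < degree \<phi>) \<and> f = (\<Sum>j | a j \<noteq> 0. a j * \<phi> ^ j)"

definition adic_development :: "int poly \<Rightarrow> int poly \<Rightarrow> nat \<Rightarrow> int poly" where
  "adic_development \<phi> f = (THE a. is_adic_development \<phi> f a)"

definition newton_points :: "nat \<Rightarrow> int poly \<Rightarrow> int poly \<Rightarrow> (real \<times> real) set" where
  "newton_points p \<phi> f =
     {(real j, real u) | j u. poly_val p (adic_development \<phi> f j) = enat u}"

definition lower_hull :: "(real \<times> real) set \<Rightarrow> (real \<times> real) set" where
  "lower_hull P =
     {(x, y). (x, y) \<in> convex hull P \<and> (\<forall>y'. (x, y') \<in> convex hull P \<longrightarrow> y \<le> y')}"

text \<open>The sides of the lower convex hull are the edges of the convex hull that lie on its lower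
  boundary; only those of negative slope are kept.\<close>

definition principal_sides :: "nat \<Rightarrow> int poly \<Rightarrow> int poly \<Rightarrow> (real \<times> real) set set" where
  "principal_sides p \<phi> f =
     {closed_segment a b | a b.
        closed_segment a b edge_of (convex hull newton_points p \<phi> f) \<and>
        closed_segment a b \<subseteq> lower_hull (newton_points p \<phi> f) \<and>
        fst a < fst b \<and> snd b < snd a}"

definition principal_polygon :: "nat \<Rightarrow> int poly \<Rightarrow> int poly \<Rightarrow> (real \<times> real) set" where
  "principal_polygon p \<phi> f = \<Union> (principal_sides p \<phi> f)"

text \<open>A lattice point lies on or below the polygon if some point of the polygon has the same abscissa
  and at least its ordinate; points beside the polygon are not counted.\<close>

definition phi_index :: "nat \<Rightarrow> int poly \<Rightarrow> int poly \<Rightarrow> nat" where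
  "phi_index p \<phi> f = degree \<phi> *
     card {(i::int, j::int). 0 < i \<and> 0 < j \<and>
             (\<exists>y. (real_of_int i, y) \<in> principal_polygon p \<phi> f \<and> real_of_int j \<le> y)}"

text \<open>The two definite descriptions above denote.\<close>

lemma is_chebyshev_unique:
  assumes "is_chebyshev d q" "is_chebyshev d q'"
  shows "q = q'"
proof -
  have "poly (of_int_poly q :: complex poly) w = poly (of_int_poly q') w" for w :: complex
  proof -
    define z where "z = (w + csqrt (w^2 - 4)) / 2"
    have e: "z * (w - z) = 1"
    proof -
      have "4 * (z * (w - z)) = w^2 - (csqrt (w^2 - 4))^2"
        by (simp add: z_def field_simps power2_eq_square)
      also have "\<dots> = 4" by simp
      finally show ?thesis by simp
    qed
    hence "z \<noteq> 0" by auto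
    have "inverse z = w - z" using e by (metis inverse_unique)
    hence "z + inverse z = w" by simp
    moreover have "poly (of_int_poly q) (z + inverse z) = poly (of_int_poly q') (z + inverse z)"
      using assms \<open>z \<noteq> 0\<close> unfolding is_chebyshev_def by presburger
    ultimately show ?thesis by (simp only:)
  qed
  hence "(of_int_poly q :: complex poly) = of_int_poly q'"
    by (intro poly_ext)
  thus ?thesis by simp
qed

fun cheb_rec :: "nat \<Rightarrow> int poly" where
  "cheb_rec 0 = [:2:]"
| "cheb_rec (Suc 0) = [:0, 1:]"
| "cheb_rec (Suc (Suc d)) = pCons 0 (cheb_rec (Suc d)) - cheb_rec d"

lemma cheb_rec_degree:
  "degree (cheb_rec (Suc d)) = Suc d \<and> lead_coeff (cheb_rec (Suc d)) = 1
   \<and> degree (cheb_rec d) \<le> d"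
proof (induction d)
  case (Suc d)
  let ?P = "pCons 0 (cheb_rec (Suc d))"
  have nz: "cheb_rec (Suc d) \<noteq> 0" using Suc by auto
  have dP: "degree ?P = Suc (Suc d)" using Suc nz by simp
  have lt: "degree (- cheb_rec d) < degree ?P" using Suc dP by simp
  have eq: "cheb_rec (Suc (Suc d)) = ?P + - cheb_rec d" by simp
  have 1: "degree (cheb_rec (Suc (Suc d))) = Suc (Suc d)"
    unfolding eq using degree_add_eq_left[OF lt] dP by simp
  have "lead_coeff (cheb_rec (Suc (Suc d))) = lead_coeff ?P"
    unfolding eq using lead_coeff_add_le[OF lt] by (simp add: add.commute)
  also have "\<dots> = 1" using Suc.IH nz dP by (metis coeff_pCons_Suc)
  finally show ?case using 1 Suc by simp
qed auto

lemma cheb_rec_eval: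
  fixes z :: complex assumes "z \<noteq> 0"
  shows "poly (of_int_poly (cheb_rec d)) (z + inverse z) = z ^ d + inverse z ^ d"
proof (induction d rule: cheb_rec.induct)
  case (3 d)
  have "poly (of_int_poly (cheb_rec (Suc (Suc d)))) (z + inverse z)
      = (z + inverse z) * (z ^ Suc d + inverse z ^ Suc d) - (z ^ d + inverse z ^ d)"
    using 3 by (simp add: of_int_poly_hom.hom_minus of_int_hom.map_poly_pCons_hom)
  also have "\<dots> = z ^ Suc (Suc d) + inverse z ^ Suc (Suc d)"
  proof -
    have "z * inverse z ^ Suc d = inverse z ^ d" "inverse z * z ^ Suc d = z ^ d"
      using assms by simp_all
    thus ?thesis by (simp only: distrib_left distrib_right power_Suc) simp
  qed
  finally show ?case .
qed auto

lemma chebyshev_ex1: "d > 0 \<Longrightarrow> \<exists>!q. is_chebyshev d q"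
proof (rule ex1I)
  assume "d > 0"
  then obtain k where k: "d = Suc k" by (cases d) auto
  show *: "is_chebyshev d (cheb_rec d)"
    unfolding is_chebyshev_def k using cheb_rec_degree[of k] cheb_rec_eval[of _ "Suc k"] by blast
  show "q = cheb_rec d" if "is_chebyshev d q" for q
    using is_chebyshev_unique[OF that *] .
qed

lemma is_chebyshev_chebyshev: "d > 0 \<Longrightarrow> is_chebyshev d (chebyshev d)"
  unfolding chebyshev_def by (rule theI') (rule chebyshev_ex1)

lemma monic_divmod_unique:
  fixes \<phi> :: "int poly"
  assumes "lead_coeff \<phi> = 1" "degree r < degree \<phi>" "degree r' < degree \<phi>"
    and eq: "r + \<phi> * q = r' + \<phi> * q'"
  shows "r = r' \<and> q = q'"
proof -
  have e: "\<phi> * (q' - q) = r - r'" using eq by (simp add: algebra_simps)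
  have "q' - q = 0"
  proof (rule ccontr)
    assume nz: "q' - q \<noteq> 0"
    have "\<phi> \<noteq> 0" using assms(1) by auto
    hence "degree (\<phi> * (q' - q)) \<ge> degree \<phi>" using nz by (simp add: degree_mult_eq)
    moreover have "degree (r - r') < degree \<phi>" using assms(2,3) by (rule degree_diff_less)
    ultimately show False using e by simp
  qed
  thus ?thesis using e by simp
qed

lemma is_adic_development_upto:
  "is_adic_development \<phi> f a \<longleftrightarrow>
     (\<forall>j. degree (a j) < degree \<phi>) \<and> (\<exists>m. (\<forall>j\<ge>m. a j = 0) \<and> f = (\<Sum>j<m. a j * \<phi> ^ j))"
proof -
  have key: "(\<Sum>j | a j \<noteq> 0. a j * \<phi> ^ j) = (\<Sum>j<m. a j * \<phi> ^ j)" if "\<forall>j\<ge>m. a j = 0" for m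
    using that by (intro sum.mono_neutral_left) (auto simp: not_le[symmetric])
  have fin: "finite {j. a j \<noteq> 0} \<longleftrightarrow> (\<exists>m. \<forall>j\<ge>m. a j = 0)"
    unfolding finite_nat_set_iff_bounded by (auto simp: not_le[symmetric])
  show ?thesis
  proof
    assume L: "is_adic_development \<phi> f a"
    then obtain m where m: "\<forall>j\<ge>m. a j = 0" unfolding is_adic_development_def fin by blast
    show "(\<forall>j. degree (a j) < degree \<phi>) \<and> (\<exists>m. (\<forall>j\<ge>m. a j = 0) \<and> f = (\<Sum>j<m. a j * \<phi> ^ j))"
      using L m unfolding is_adic_development_def key[OF m] by blast
  next
    assume R: "(\<forall>j. degree (a j) < degree \<phi>) \<and> (\<exists>m. (\<forall>j\<ge>m. a j = 0) \<and> f = (\<Sum>j<m. a j * \<phi> ^ j))"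
    then obtain m where m: "\<forall>j\<ge>m. a j = 0" and f: "f = (\<Sum>j<m. a j * \<phi> ^ j)" by blast
    show "is_adic_development \<phi> f a"
      unfolding is_adic_development_def fin key[OF m] using R m f by blast
  qed
qed

lemma sum_adic_shift:
  fixes \<phi> :: "int poly"
  shows "(\<Sum>j<Suc m. a j * \<phi> ^ j) = a 0 + \<phi> * (\<Sum>j<m. a (Suc j) * \<phi> ^ j)"
  by (simp add: sum.lessThan_Suc_shift sum_distrib_left algebra_simps del: sum.lessThan_Suc)

lemma adic_development_ex:
  fixes \<phi> :: "int poly"
  assumes m: "lead_coeff \<phi> = 1" and d: "degree \<phi> > 0"
  shows "\<exists>a. is_adic_development \<phi> f a"
proof (induction "degree f" arbitrary: f rule: less_induct)
  case less
  show ?case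
  proof (cases "degree f < degree \<phi>")
    case True
    then show ?thesis unfolding is_adic_development_upto
      by (intro exI[of _ "\<lambda>j. if j = 0 then f else 0"])
        (use d in \<open>auto intro!: exI[of _ "Suc 0"]\<close>)
  next
    case False
    obtain q r where qr: "pseudo_divmod f \<phi> = (q, r)" by (meson surj_pair)
    have nz: "\<phi> \<noteq> 0" using m by auto
    from pseudo_divmod[OF nz qr] m d
    have f: "f = \<phi> * q + r" and r: "degree r < degree \<phi>" by auto
    have "q \<noteq> 0" using False f r by auto
    hence dq: "degree (\<phi> * q) = degree \<phi> + degree q" using nz by (simp add: degree_mult_eq)
    hence "degree f = degree \<phi> + degree q" using f r by (simp add: degree_add_eq_left)
    hence "degree q < degree f" using d by simp
    from less[OF this] obtain b k where b: "\<forall>j. degree (b j) < degree \<phi>"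
      "\<forall>j\<ge>k. b j = 0" "q = (\<Sum>j<k. b j * \<phi> ^ j)"
      unfolding is_adic_development_upto by blast
    show ?thesis unfolding is_adic_development_upto
    proof (intro exI conjI)
      show "\<forall>j. degree (case_nat r b j) < degree \<phi>" using b r by (auto split: nat.split)
      show "\<forall>j\<ge>Suc k. case_nat r b j = 0" using b by (auto split: nat.split)
      show "f = (\<Sum>j<Suc k. case_nat r b j * \<phi> ^ j)"
        unfolding sum_adic_shift using f b(3) by simp
    qed
  qed
qed

lemma adic_development_unique:
  fixes \<phi> :: "int poly"
  assumes m: "lead_coeff \<phi> = 1"
    and a: "is_adic_development \<phi> f a" and b: "is_adic_development \<phi> f b"
  shows "a = b"
proof -
  have *: "\<forall>j. a j = b j" if "\<forall>j. degree (a j) < degree \<phi>" "\<forall>j. degree (b j) < degree \<phi>"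
    "\<forall>j\<ge>k. a j = 0" "\<forall>j\<ge>k. b j = 0"
    "(\<Sum>j<k. a j * \<phi> ^ j) = (\<Sum>j<k. b j * \<phi> ^ j)" for k a b
    using that
  proof (induction k arbitrary: a b)
    case (Suc k)
    have e: "a 0 = b 0 \<and> (\<Sum>j<k. a (Suc j) * \<phi> ^ j) = (\<Sum>j<k. b (Suc j) * \<phi> ^ j)"
      by (rule monic_divmod_unique[OF m])
        (use Suc.prems in \<open>auto simp: sum_adic_shift[symmetric] simp del: sum.lessThan_Suc\<close>)
    have "\<forall>j. a (Suc j) = b (Suc j)"
      by (rule Suc.IH) (use Suc.prems e in auto)
    thus ?case using e by (metis not0_implies_Suc)
  qed auto
  obtain k l where k: "\<forall>j\<ge>k. a j = 0" and l: "\<forall>j\<ge>l. b j = 0"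
    using a b unfolding is_adic_development_upto by blast
  have ext: "(\<Sum>j | c j \<noteq> 0. c j * \<phi> ^ j) = (\<Sum>j<n. c j * \<phi> ^ j)" if "\<forall>j\<ge>n. c j = 0" for c n
    using that by (intro sum.mono_neutral_left) (auto simp: not_le[symmetric])
  have "\<forall>j. a j = b j"
  proof (rule *[of _ _ "max k l"])
    show "(\<Sum>j<max k l. a j * \<phi> ^ j) = (\<Sum>j<max k l. b j * \<phi> ^ j)"
      using a b k l ext[of "max k l" a] ext[of "max k l" b]
      unfolding is_adic_development_def by simp
  qed (use a b k l in \<open>auto simp: is_adic_development_def\<close>)
  thus ?thesis by blast
qed

lemma is_adic_development_adic_development:
  fixes \<phi> :: "int poly"
  assumes "lead_coeff \<phi> = 1" "degree \<phi> > 0"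
  shows "is_adic_development \<phi> f (adic_development \<phi> f)"
  unfolding adic_development_def
proof (rule theI'[of "is_adic_development \<phi> f"])
  obtain a where a: "is_adic_development \<phi> f a" using adic_development_ex[OF assms] by blast
  show "\<exists>!a. is_adic_development \<phi> f a"
  proof (rule ex1I)
    show "is_adic_development \<phi> f a" by (rule a)
    show "b = a" if "is_adic_development \<phi> f b" for b
      using adic_development_unique[OF assms(1) that a] .
  qed
qed

end

theory Submission
  imports Defs
begin

text \<open>
  Put \<open>T = T_D\<close> with \<open>D = l^n\<close> and \<open>w = x - \<epsilon>\<close>. Then \<open>T - \<epsilon> = w G^2\<close> for a monic integral \<open>G\<close>, and
  substituting this in \<open>(x^2 - 4) T'^2 = D^2 (T^2 - 4)\<close> gives
  \<open>(x + \<epsilon>) (G + 2 w G')^2 - D^2 w G^2 = 2 \<epsilon> D^2\<close>. The right-hand side is a unit modulo \<open>p\<close>, so modulo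
  \<open>p\<close> the polynomial \<open>G\<close> is squarefree and prime to \<open>w\<close>. Hence each \<open>\<phi>_i\<close> is a simple factor of
  \<open>G\<close> modulo \<open>p\<close>, and by Hensel's lemma it lifts to \<open>\<phi>'\<close> with \<open>G \<equiv> \<phi>' H\<close> modulo \<open>p^(V+1)\<close>. So
  \<open>\<Phi> \<equiv> w H^2 \<phi>'^2 - (t - \<epsilon>)\<close> modulo \<open>p^(V+1)\<close>, where \<open>\<phi>'\<close> does not divide \<open>w H^2\<close> modulo \<open>p\<close>, and
  the first three coefficients of the \<open>\<phi>'\<close>-adic development have valuations \<open>V\<close>, more than \<open>V\<close>,
  and \<open>0\<close>. For \<open>w\<close> itself the second coefficient is \<open>G(\<epsilon>)^2 = D^2\<close>, a unit modulo \<open>p\<close>.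
\<close>

section \<open>Chebyshev polynomials\<close>

text \<open>The roots of \<open>Z^2 - w * Z + 1\<close> have sum \<open>w\<close> and product 1.
  Hence \<open>z + 1/z\<close> is surjective, and polynomial identities may be checked after
  substituting it.\<close>

lemma complex_eq_add_inverse:
  obtains z :: complex where "z \<noteq> 0" "w = z + inverse z"
proof -
  define z where "z = (w + csqrt (w^2 - 4)) / 2"
  have "4 * (z * (w - z)) = w^2 - (csqrt (w^2 - 4))^2"
    by (simp add: z_def field_simps power2_eq_square)
  hence e: "z * (w - z) = 1" by simp
  hence "z \<noteq> 0" by auto
  moreover have "inverse z = w - z" using e by (metis inverse_unique)
  ultimately show ?thesis using that[of z] by simp
qed

lemma int_poly_eqI_add_inverse:
  fixes P Q :: "int poly"
  assumes "\<And>z::complex. z \<noteq> 0 \<Longrightarrow>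
    poly (of_int_poly P) (z + inverse z) = poly (of_int_poly Q) (z + inverse z)"
  shows "P = Q"
proof -
  have "poly (of_int_poly P :: complex poly) w = poly (of_int_poly Q) w" for w
    using assms by (metis complex_eq_add_inverse)
  hence "(of_int_poly P :: complex poly) = of_int_poly Q" by (intro poly_ext)
  thus ?thesis by simp
qed

text \<open>In the coordinate \<open>z + 1/z\<close> the polynomial \<open>q\<close> is the power
  map \<open>z^d\<close>, so composition multiplies exponents. The iterate is itself a Chebyshev
  polynomial, and iteration plays no further part.\<close>

lemma is_chebyshev_iterate:
  assumes "is_chebyshev d q" "d > 0"
  shows "is_chebyshev (d ^ n) (poly_iterate q n)"
proof (induction n)
  case 0
  show ?case by (simp add: poly_iterate_def is_chebyshev_def of_int_hom.map_poly_pCons_hom)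
next
  case (Suc n)
  have step: "poly_iterate q (Suc n) = pcompose q (poly_iterate q n)"
    by (simp add: poly_iterate_def)
  have pos: "degree (poly_iterate q n) > 0"
    using Suc assms by (simp add: is_chebyshev_def)
  have "poly (of_int_poly (poly_iterate q (Suc n))) (z + inverse z)
      = z ^ d ^ Suc n + inverse z ^ d ^ Suc n" if "z \<noteq> 0" for z :: complex
  proof -
    have "poly (of_int_poly (poly_iterate q (Suc n))) (z + inverse z)
        = poly (of_int_poly q) (z ^ d ^ n + inverse (z ^ d ^ n))"
      using Suc that
      by (simp add: step of_int_hom.map_poly_pcompose poly_pcompose is_chebyshev_def power_inverse)
    also have "\<dots> = (z ^ d ^ n) ^ d + inverse (z ^ d ^ n) ^ d"
      using assms(1) that by (simp add: is_chebyshev_def)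
    finally show ?thesis by (simp add: power_inverse power_mult[symmetric] mult.commute)
  qed
  moreover have "lead_coeff (poly_iterate q (Suc n)) = 1"
  proof -
    have "lead_coeff q = 1" "lead_coeff (poly_iterate q n) = 1"
      using Suc assms unfolding is_chebyshev_def by blast+
    thus ?thesis unfolding step lead_coeff_comp[OF pos] by simp
  qed
  moreover have "degree (poly_iterate q (Suc n)) = d ^ Suc n"
    unfolding step using Suc assms by (simp add: is_chebyshev_def)
  ultimately show ?case unfolding is_chebyshev_def by blast
qed

text \<open>For \<open>s = 1\<close> and \<open>s = -1\<close> this is the polynomial \<open>(z^(2m+1) - s) / (z^m * (z - s))\<close> in
  \<open>z + 1/z\<close>.\<close>

fun cheb_root :: "int \<Rightarrow> nat \<Rightarrow> int poly" where
  "cheb_root s 0 = 1"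
| "cheb_root s (Suc 0) = [:s, 1:]"
| "cheb_root s (Suc (Suc m)) = pCons 0 (cheb_root s (Suc m)) - cheb_root s m"

lemma cheb_root_degree:
  "degree (cheb_root s m) = m \<and> lead_coeff (cheb_root s m) = 1"
proof (induction s m rule: cheb_root.induct)
  case (3 s m)
  let ?P = "pCons 0 (cheb_root s (Suc m))"
  have nz: "cheb_root s (Suc m) \<noteq> 0" using 3 by auto
  have dP: "degree ?P = Suc (Suc m)" using 3 nz by simp
  have lt: "degree (- cheb_root s m) < degree ?P" using 3 dP by simp
  have eq: "cheb_root s (Suc (Suc m)) = ?P + - cheb_root s m" by simp
  have 1: "degree (cheb_root s (Suc (Suc m))) = Suc (Suc m)"
    unfolding eq using degree_add_eq_left[OF lt] dP by simp
  have "lead_coeff (cheb_root s (Suc (Suc m))) = lead_coeff ?P"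
    unfolding eq using lead_coeff_add_le[OF lt] by (simp add: add.commute)
  also have "\<dots> = 1" using 3 nz dP by (metis coeff_pCons_Suc)
  finally show ?case using 1 by simp
qed auto

text \<open>Both sides satisfy \<open>X (m + 2) = (z^2 + 1) * X (m + 1) - z^2 * X m\<close>. With
  the denominators cleared, the identity also holds at \<open>z = s\<close>.\<close>

lemma cheb_root_eval:
  fixes z :: complex
  assumes "z \<noteq> 0" and "s^2 = 1"
  shows "(z - of_int s) * (poly (of_int_poly (cheb_root s m)) (z + inverse z) * z ^ m)
    = z ^ (2 * m + 1) - of_int s"
  using assms(2)
proof (induction s m rule: cheb_root.induct)
  case (2 s)
  have s: "of_int s * of_int s = (1::complex)"
    using 2 by (metis of_int_1 of_int_mult power2_eq_square)
  have "(z - of_int s) * (of_int s + (z + inverse z)) * z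
      = z ^ 3 - of_int s * (z * inverse z)
        + z * (z * inverse z - of_int s * of_int s)"
    by (simp add: algebra_simps power2_eq_square power3_eq_cube)
  also have "\<dots> = z ^ 3 - of_int s" unfolding s using assms(1) by simp
  finally show ?case by (simp add: of_int_hom.map_poly_pCons_hom power3_eq_cube algebra_simps)
next
  case (3 s m)
  define a b where "a = poly (of_int_poly (cheb_root s (Suc m))) (z + inverse z)"
    and "b = poly (of_int_poly (cheb_root s m)) (z + inverse z)"
  define c :: complex where "c = of_int s"
  \<comment> \<open>The hypothesis on \<open>w\<close> is the cleared form of
    \<open>w = z + 1/z\<close>; it keeps inverses out of the algebra.\<close>
  have alg: "(z - c) * ((w * a - b) * (z * (z * y)))
      = (z^2 + 1) * ((z - c) * (a * (z * y))) - z^2 * ((z - c) * (b * y))"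
    if "z * w = z^2 + 1" for w y
    unfolding that[symmetric] by (simp add: algebra_simps power2_eq_square)
  have "(z - c) * (((z + inverse z) * a - b) * z ^ Suc (Suc m))
      = (z^2 + 1) * ((z - c) * (a * z ^ Suc m)) - z^2 * ((z - c) * (b * z ^ m))"
    unfolding power_Suc
    by (rule alg) (use assms(1) in \<open>simp add: algebra_simps power2_eq_square\<close>)
  also have "\<dots> = (z^2 + 1) * (z ^ (2 * Suc m + 1) - c) - z^2 * (z ^ (2 * m + 1) - c)"
    using 3 unfolding a_def b_def c_def by (simp only:)
  also have "\<dots> = z ^ (2 * Suc (Suc m) + 1) - c"
    by (simp add: algebra_simps power2_eq_square)
  finally show ?case
    by (simp add: a_def b_def c_def of_int_poly_hom.hom_minus of_int_hom.map_poly_pCons_hom)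
qed auto

section \<open>The square and Pell identities\<close>

text \<open>With \<open>x = z + 1/z\<close> and \<open>D = 2 * m + 1\<close>, \<open>s^2 = 1\<close>
  gives \<open>x - 2 * s = (z - s)^2 / z\<close> and \<open>T - 2 * s = (z^D - s)^2 / z^D\<close>.
  Their quotient is the square of \<open>(z^D - s) / (z^m * (z - s))\<close>.\<close>

lemma chebyshev_eq_square:
  assumes T: "is_chebyshev (2 * m + 1) T" and s: "s^2 = 1"
  shows "T = [:- (2 * s), 1:] * (cheb_root s m)^2 + [:2 * s:]"
proof (rule int_poly_eqI_add_inverse)
  fix z :: complex
  assume z: "z \<noteq> 0"
  define D where "D = 2 * m + 1"
  define c :: complex where "c = of_int s"
  define g where "g = poly (of_int_poly (cheb_root s m)) (z + inverse z)"
  have c: "c * c = 1"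
    using s unfolding c_def by (metis of_int_1 of_int_mult power2_eq_square)
  have zi: "z * inverse z = 1" using z by simp
  have g: "(z - c) * (g * z ^ m) = z ^ D - c"
    using cheb_root_eval[OF z s, of m] by (simp add: g_def c_def D_def)
  have "z ^ D * (((z + inverse z) - 2 * c) * g^2 + 2 * c)
      = (z^2 + z * inverse z - 2 * c * z) * (g * z ^ m)^2 + 2 * c * z ^ D"
    by (simp add: D_def algebra_simps power2_eq_square power_mult power_mult_distrib)
  also have "z^2 + z * inverse z - 2 * c * z = (z - c)^2"
    using c zi by (simp add: algebra_simps power2_eq_square)
  also have "(z - c)^2 * (g * z ^ m)^2 + 2 * c * z ^ D = (z ^ D)^2 + 1"
    unfolding power_mult_distrib[symmetric] g using c by (simp add: algebra_simps power2_eq_square)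
  also have "\<dots> = z ^ D * (z ^ D + inverse z ^ D)"
    using z by (simp add: algebra_simps power2_eq_square power_inverse)
  finally have "((z + inverse z) - 2 * c) * g^2 + 2 * c = z ^ D + inverse z ^ D"
    using z by simp
  moreover have "poly (of_int_poly T) (z + inverse z) = z ^ D + inverse z ^ D"
    using T z by (simp add: is_chebyshev_def D_def)
  ultimately show "poly (of_int_poly T) (z + inverse z)
      = poly (of_int_poly ([:- (2 * s), 1:] * (cheb_root s m)^2 + [:2 * s:])) (z + inverse z)"
    by (simp add: hom_distribs g_def c_def of_int_hom.map_poly_pCons_hom algebra_simps)
qed

text \<open>Applying \<open>z d/dz\<close> to \<open>T (z + 1/z) = z^D + 1/z^D\<close> gives
  \<open>T' * (z - 1/z) = D * (z^D - 1/z^D)\<close>. Squaring makes both differences polynomial in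
  the corresponding sums.\<close>

lemma chebyshev_pell:
  assumes T: "is_chebyshev D T"
  shows "[:-4, 0, 1:] * (pderiv T)^2 = [:int D ^ 2:] * (T^2 - [:4:])"
proof (rule int_poly_eqI_add_inverse)
  fix z :: complex
  assume z: "z \<noteq> 0"
  define P :: "complex poly" where "P = of_int_poly T"
  have eq: "poly P (x + inverse x) = x ^ D + inverse x ^ D" if "x \<noteq> 0" for x
    using T that by (simp add: is_chebyshev_def P_def)
  have d1: "((\<lambda>x. poly P (x + inverse x)) has_field_derivative
      poly (pderiv P) (z + inverse z) * (1 - inverse z * inverse z)) (at z)"
    by (rule DERIV_chain2[OF poly_DERIV]) (use z in \<open>auto intro!: derivative_eq_intros\<close>)
  have d2: "((\<lambda>x. x ^ D + inverse x ^ D) has_field_derivative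
      of_nat D * z ^ (D - 1) - of_nat D * inverse z ^ (D - 1) * (inverse z * inverse z)) (at z)"
    by (use z in \<open>auto intro!: derivative_eq_intros\<close>)
  \<comment> \<open>The two functions are known to agree away from 0 only; agreement near
    \<open>z\<close> is enough to equate derivatives.\<close>
  have ev: "\<forall>\<^sub>F x in nhds z. poly P (x + inverse x) = x ^ D + inverse x ^ D"
    by (rule eventually_mono[OF eventually_nhds_in_open[of "- {0}" z]]) (use z eq in auto)
  have "poly (pderiv P) (z + inverse z) * (1 - inverse z * inverse z)
      = of_nat D * z ^ (D - 1) - of_nat D * inverse z ^ (D - 1) * (inverse z * inverse z)"
    by (rule DERIV_unique[OF d1 iffD2[OF DERIV_cong_ev[OF refl ev refl] d2]])
  moreover have "of_nat D * z ^ (D - 1) * z = of_nat D * z ^ D"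
    "of_nat D * inverse z ^ (D - 1) * inverse z = of_nat D * inverse z ^ D"
    by (cases D; simp)+
  moreover have "d * (z - y) = M - N"
    if "d * (1 - y * y) = m - n * (y * y)" "m * z = M" "n * y = N" "z * y = 1"
    for d y m n M N
  proof -
    have "d * (z - y) = d * (z - y * (z * y))" using that(4) by simp
    also have "\<dots> = z * (d * (1 - y * y))" by (simp add: algebra_simps)
    also have "\<dots> = m * z - n * y * (z * y)" unfolding that(1) by (simp add: algebra_simps)
    finally show ?thesis using that by simp
  qed
  ultimately have "poly (pderiv P) (z + inverse z) * (z - inverse z)
      = of_nat D * z ^ D - of_nat D * inverse z ^ D"
    using z by (metis right_inverse)
  hence "poly (pderiv P) (z + inverse z) * (z - inverse z)
      = of_nat D * (z ^ D - inverse z ^ D)"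
    by (simp add: right_diff_distrib)
  hence "(z - inverse z)^2 * poly (pderiv P) (z + inverse z)^2
      = of_nat D^2 * (z ^ D - inverse z ^ D)^2"
    by (metis power_mult_distrib mult.commute)
  moreover have "(z - inverse z)^2 = (z + inverse z)^2 - 4"
    "(z ^ D - inverse z ^ D)^2 = (z ^ D + inverse z ^ D)^2 - 4"
    using z by (simp_all add: power2_eq_square algebra_simps power_inverse)
  ultimately have "((z + inverse z)^2 - 4) * poly (pderiv P) (z + inverse z)^2
      = of_nat D^2 * (poly P (z + inverse z)^2 - 4)"
    using eq[OF z] by simp
  thus "poly (of_int_poly ([:-4, 0, 1:] * (pderiv T)^2)) (z + inverse z)
      = poly (of_int_poly ([:int D ^ 2:] * (T^2 - [:4:]))) (z + inverse z)"
    by (simp add: hom_distribs P_def of_int_hom.map_poly_pderiv of_int_hom.map_poly_pCons_hom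
        power2_eq_square algebra_simps)
qed

text \<open>The factor \<open>[:- (2 * s), 1:]\<close> in the second term makes one identity serve
  twice: modulo a prime not dividing the constant, \<open>cheb_root s m\<close> shares no
  irreducible factor with that linear polynomial, nor with its own derivative.\<close>

lemma cheb_root_bezout:
  assumes T: "is_chebyshev (2 * m + 1) T" and s: "s^2 = 1"
  shows "\<exists>a c. a * cheb_root s m + [:- (2 * s), 1:] * c * pderiv (cheb_root s m)
    = [:4 * s * int (2 * m + 1)^2:]"
proof -
  define G w v N where "G = cheb_root s m" and "w = [:- (2 * s), 1:]" and "v = [:2 * s, 1:]"
    and "N = [:int (2 * m + 1)^2:]"
  have TG: "T = w * G^2 + [:2 * s:]"
    using chebyshev_eq_square[OF T s] by (simp add: G_def w_def)
  have w': "pderiv w = 1" by (simp add: w_def pderiv_pCons)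
  have ww: "[:-4, 0, 1:] = w * v"
    using s by (simp add: w_def v_def power2_eq_square)
  \<comment> \<open>This is \<open>T^2 - 4 = (T - 2 * s) * (T + 2 * s)\<close>.\<close>
  have T4: "T^2 - [:4:] = w * G^2 * (w * G^2 + [:4 * s:])"
  proof -
    have "[:2 * s:] * [:2 * s:] = [:4:]" "[:4 * s:] = [:2 * s:] + [:2 * s:]"
      using s by (simp_all add: power2_eq_square)
    moreover have "(X + E)^2 - E * E = X * (X + (E + E))" for X E :: "int poly"
      by (simp add: algebra_simps power2_eq_square)
    ultimately show ?thesis unfolding TG by metis
  qed
  have T': "pderiv T = G * (G + 2 * w * pderiv G)"
    unfolding TG by (simp add: pderiv_add pderiv_mult pderiv_pCons w' power2_eq_square algebra_simps)
  have G0: "w * G^2 \<noteq> 0"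
  proof -
    have "G \<noteq> 0" using cheb_root_degree[of s m] by (metis G_def leading_coeff_0_iff zero_neq_one)
    thus ?thesis by (simp add: w_def del: mult_pCons_left)
  qed
  have "w * v * (G * (G + 2 * w * pderiv G))^2 = N * (w * G^2 * (w * G^2 + [:4 * s:]))"
    using chebyshev_pell[OF T] unfolding ww T4 T' N_def .
  hence "w * G^2 * (v * (G + 2 * w * pderiv G)^2) = w * G^2 * (N * (w * G^2 + [:4 * s:]))"
    by (simp add: power_mult_distrib mult_ac)
  hence key: "v * (G + 2 * w * pderiv G)^2 = N * (w * G^2 + [:4 * s:])"
    using G0 mult_left_cancel by blast
  \<comment> \<open>Expand the square in \<open>key\<close>: every term containing \<open>G\<close>
    goes into the first coefficient, and \<open>4 * v * w^2 * (pderiv G)^2\<close> remains.\<close>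
  have "(v * (G + 4 * w * pderiv G) - N * w * G) * G + w * (4 * v * w * pderiv G) * pderiv G
      = v * (G + 2 * w * pderiv G)^2 - N * (w * G^2)"
    by (simp add: algebra_simps power2_eq_square)
  also have "\<dots> = N * [:4 * s:]" unfolding key by (simp add: algebra_simps)
  also have "\<dots> = [:4 * s * int (2 * m + 1)^2:]" by (simp add: N_def mult_ac)
  finally show ?thesis unfolding G_def w_def by blast
qed

section \<open>Lifting a simple factor modulo a prime\<close>

lemma monic_divmod_ex:
  fixes \<phi> :: "int poly"
  assumes "lead_coeff \<phi> = 1" "degree \<phi> > 0"
  obtains q r where "f = r + \<phi> * q" "degree r < degree \<phi>"
proof -
  obtain q r where qr: "pseudo_divmod f \<phi> = (q, r)" by fastforce
  have "\<phi> \<noteq> 0" using assms by auto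
  from pseudo_divmod[OF this qr] assms have "f = r + \<phi> * q" "degree r < degree \<phi>" by auto
  thus ?thesis using that by blast
qed

section \<open>Divisibility of integer polynomials modulo a prime\<close>

context poly_mod_prime
begin

lemma eq_m_iff: "f =m g \<longleftrightarrow> (\<exists>r. f = g + smult p r)"
proof
  assume "f =m g"
  hence "f = g + smult p (Dp f - Dp g)"
    using Dp_Mp_eq[of f] Dp_Mp_eq[of g] by (simp add: smult_diff_right)
  thus "\<exists>r. f = g + smult p r" by blast
next
  assume "\<exists>r. f = g + smult p r"
  then obtain r where "f = g + smult p r" by blast
  thus "f =m g" by (metis plus_Mp(2) Mp_smult_m_0 add.right_neutral)
qed

lemma dvdm_mult_left: "f dvdm g \<Longrightarrow> f dvdm h * g"
  by (metis dvdm_factor mult.commute)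

lemma dvdm_diff: "f dvdm g \<Longrightarrow> f dvdm h \<Longrightarrow> f dvdm g - h"
  using dvdm_add[of f g "- h"] by simp

lemma dvdm_cong: "g =m h \<Longrightarrow> f dvdm g \<longleftrightarrow> f dvdm h"
  unfolding dvdm_def by simp

lemma eq_m_add: "f =m f' \<Longrightarrow> g =m g' \<Longrightarrow> f + g =m f' + g'"
  by (metis plus_Mp)

lemma eq_m_mult: "f =m f' \<Longrightarrow> g =m g' \<Longrightarrow> f * g =m f' * g'"
  by (metis mult_Mp)

lemma dvdm_trans:
  assumes "f dvdm g" "g dvdm h"
  shows "f dvdm h"
proof -
  obtain i j where "g =m f * i" "h =m g * j" using assms by (auto simp: dvdm_def)
  hence "h =m f * (i * j)" using eq_m_mult[of g "f * i" j j] by (simp add: mult.assoc)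
  thus ?thesis by (auto simp: dvdm_def)
qed

text \<open>The leading coefficient of \<open>Mp f\<close> is invertible modulo \<open>p\<close>.
  Reducing after the multiplication makes the result monic over the integers, so degrees of monic
  elements can be compared.\<close>

lemma monic_multiple_ex:
  assumes "\<not> f =m 0"
  obtains d where "lead_coeff (Mp (smult d f)) = 1"
    "degree (Mp (smult d f)) \<le> degree f"
proof -
  define c where "c = lead_coeff (Mp f)"
  have "c = coeff f (degree_m f) mod p" by (simp add: c_def Mp_coeff M_def)
  moreover have "c \<noteq> 0" using assms by (simp add: c_def)
  ultimately have "\<not> p dvd c" by (auto simp: dvd_eq_mod_eq_0)
  hence "Rings.coprime c p" using prime_imp_coprime[OF prime] Rings.coprime_commute by metis
  then obtain d where "[c * d = 1] (mod p)" using cong_solve_coprime_int by blast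
  hence d: "c * d mod p = 1" using m1 by (simp add: cong_def)
  have eq: "Mp (smult d f) = Mp (smult d (Mp f))" by simp
  have top: "coeff (Mp (smult d f)) (degree_m f) = 1"
    unfolding eq Mp_coeff M_def using d by (simp add: c_def mult.commute)
  have "degree (Mp (smult d f)) \<le> degree_m f"
    unfolding eq using degree_m_le degree_smult_le order_trans by blast
  moreover have "degree_m f \<le> degree (Mp (smult d f))"
    using top by (intro le_degree) simp
  ultimately have deg: "degree (Mp (smult d f)) = degree_m f" by simp
  show ?thesis
  proof (rule that)
    show "lead_coeff (Mp (smult d f)) = 1" unfolding deg by (rule top)
    show "degree (Mp (smult d f)) \<le> degree f" unfolding deg by (rule degree_m_le)
  qed
qed

text \<open>The generator of the ideal \<open>(f, g)\<close> modulo \<open>p\<close> is a monic element of least degree.\<close>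

lemma irreducible_m_bezout:
  assumes irr: "irreducible_m f" and monic: "lead_coeff f = 1" and nd: "\<not> f dvdm g"
  shows "\<exists>u v. u * f + v * g =m 1"
proof -
  define I where "I = {h. \<exists>u v. u * f + v * g =m h}"
  have I_mult: "a * h \<in> I" if h: "h \<in> I" for a h
  proof -
    obtain u v where "u * f + v * g =m h" using h unfolding I_def by blast
    hence "(a * u) * f + (a * v) * g =m a * h"
      using eq_m_mult[of a a "u * f + v * g" h] by (simp add: algebra_simps)
    thus ?thesis unfolding I_def by blast
  qed
  have I_add: "h + h' \<in> I" if hh: "h \<in> I" "h' \<in> I" for h h'
  proof -
    obtain u v u' v' where "u * f + v * g =m h" "u' * f + v' * g =m h'"
      using hh unfolding I_def by blast
    hence "(u + u') * f + (v + v') * g =m h + h'"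
      using eq_m_add[of "u * f + v * g" h "u' * f + v' * g" h'] by (simp add: algebra_simps)
    thus ?thesis unfolding I_def by blast
  qed
  have I_Mp: "Mp h \<in> I" if "h \<in> I" for h
    using that by (simp add: I_def)
  have f: "f \<in> I" unfolding I_def by (rule CollectI, rule exI[of _ 1], rule exI[of _ 0]) simp
  have g: "g \<in> I" unfolding I_def by (rule CollectI, rule exI[of _ 0], rule exI[of _ 1]) simp
  define Q where "Q h \<longleftrightarrow> h \<in> I \<and> lead_coeff h = 1" for h
  define h where "h = arg_min degree Q"
  have "Q f" using f monic by (simp add: Q_def)
  hence "Q h" unfolding h_def by (rule arg_min_natI)
  hence h: "h \<in> I" "lead_coeff h = 1" by (simp_all add: Q_def)
  have h_min: "degree h \<le> degree h'" if "h' \<in> I" "lead_coeff h' = 1" for h'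
    unfolding h_def by (rule arg_min_nat_le) (simp add: Q_def that)
  have h_dvdm: "h dvdm x" if x: "x \<in> I" for x
  proof (cases "degree h = 0")
    case True
    hence "h = 1" using h(2) by (metis degree_0_id pCons_one)
    thus ?thesis using dvd_imp_dvdm by simp
  next
    case False
    then obtain q r where qr: "x = r + h * q" "degree r < degree h"
      using monic_divmod_ex[OF h(2)] by blast
    have "r = x + (- q) * h" using qr(1) by simp
    hence r: "r \<in> I" using I_add[OF x I_mult[OF h(1), of "- q"]] by simp
    have "r =m 0"
    proof (rule ccontr)
      \<comment> \<open>A monic multiple of the remainder would be an element of the ideal of degree
        below that of \<open>h\<close>.\<close>
      assume "\<not> r =m 0"
      then obtain d where d: "lead_coeff (Mp (smult d r)) = 1"
        "degree (Mp (smult d r)) \<le> degree r" by (rule monic_multiple_ex)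
      have "Mp (smult d r) \<in> I"
        using I_Mp[OF I_mult[OF r, of "[:d:]"]] by simp
      thus False using h_min[OF _ d(1)] d(2) qr(2) by simp
    qed
    hence "x =m h * q" unfolding qr(1) using eq_m_add[of r 0 "h * q" "h * q"] by simp
    thus ?thesis by (auto simp: dvdm_def)
  qed
  obtain k where k: "f =m h * k" using h_dvdm[OF f] by (auto simp: dvdm_def)
  \<comment> \<open>Irreducibility makes \<open>h\<close> or \<open>k\<close> a unit modulo
    \<open>p\<close>. If it were \<open>k\<close>, then \<open>f\<close> would divide
    \<open>h\<close> and hence \<open>g\<close>.\<close>
  have "\<not> k dvdm 1"
  proof
    assume "k dvdm 1"
    then obtain j where "1 =m k * j" by (auto simp: dvdm_def)
    hence "h =m (h * k) * j" using eq_m_mult[of h h 1 "k * j"] by (simp add: mult.assoc)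
    also have "(h * k) * j =m f * j" using k eq_m_mult[of "h * k" f j j] by simp
    finally have "f dvdm h" by (auto simp: dvdm_def)
    thus False using nd dvdm_trans h_dvdm[OF g] by blast
  qed
  hence "h dvdm 1" using irr k unfolding irreducible_m_def by blast
  then obtain j where "1 =m h * j" by (auto simp: dvdm_def)
  moreover obtain u v where "u * f + v * g =m h * j"
    using I_mult[OF h(1), of j] unfolding I_def mult.commute[of j] by blast
  ultimately show ?thesis by metis
qed

text \<open>If \<open>f\<close> does not divide \<open>g\<close>, the Bezout identity multiplied by
  \<open>h\<close> writes \<open>h\<close> as a combination of \<open>f\<close> and
  \<open>g * h\<close>.\<close>

lemma irreducible_m_dvdm_mult:
  assumes f: "irreducible_m f" "lead_coeff f = 1"
  shows "f dvdm g * h \<longleftrightarrow> f dvdm g \<or> f dvdm h"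
proof
  assume gh: "f dvdm g * h"
  have "f dvdm h" if nd: "\<not> f dvdm g"
  proof -
    obtain u v where "u * f + v * g =m 1" using irreducible_m_bezout[OF f nd] by blast
    hence "h * (u * f + v * g) =m h" using eq_m_mult[of h h _ 1] by simp
    moreover have "h * (u * f + v * g) = (h * u) * f + v * (g * h)" by (simp add: algebra_simps)
    moreover have "f dvdm (h * u) * f + v * (g * h)"
      by (rule dvdm_add[OF dvdm_mult_left[OF dvd_imp_dvdm[OF dvd_refl]] dvdm_mult_left[OF gh]])
    ultimately show ?thesis using dvdm_cong by metis
  qed
  thus "f dvdm g \<or> f dvdm h" by blast
next
  assume "f dvdm g \<or> f dvdm h"
  thus "f dvdm g * h" using dvdm_mult_left dvdm_factor by blast
qed

section \<open>Square factors and derivatives modulo a prime\<close>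

lemma square_dvdm_imp_dvdm_pderiv:
  assumes "f^2 dvdm g"
  shows "f dvdm pderiv g"
proof -
  obtain q r where "g = q * f^2 + smult p r"
    using assms dvdm_imp_div_mod by blast
  hence "pderiv g = (pderiv q * f + 2 * q * pderiv f) * f + smult p (pderiv r)"
    by (simp add: pderiv_add pderiv_mult pderiv_smult power2_eq_square algebra_simps)
  thus ?thesis using div_mod_imp_dvdm by blast
qed

lemma square_dvdm_imp_dvdm:
  "f^2 dvdm g \<Longrightarrow> f dvdm g"
  by (metis dvdm_def mult.assoc power2_eq_square)

text \<open>The delicate case is \<open>f dvdm w\<close>. There \<open>f\<close> also divides the
  derivative \<open>g^2 + 2 * g * pderiv g * w\<close> of \<open>w * g^2\<close>, hence
  \<open>g^2\<close>.\<close>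

lemma irreducible_m_dvdm_of_square:
  assumes f: "irreducible_m f" "lead_coeff f = 1" and w: "pderiv w = 1" and dvd: "f^2 dvdm w * g^2"
  shows "f dvdm g"
proof -
  have "f dvdm w \<or> f dvdm g"
    using square_dvdm_imp_dvdm[OF dvd]
    by (simp add: power2_eq_square irreducible_m_dvdm_mult[OF f])
  moreover have "f dvdm g" if "f dvdm w"
  proof -
    have "pderiv (w * g^2) = g * g + (2 * g * pderiv g) * w"
      by (simp add: pderiv_mult w power2_eq_square algebra_simps)
    hence "g * g = pderiv (w * g^2) - (2 * g * pderiv g) * w" by simp
    hence "f dvdm g * g"
      using dvdm_diff[OF square_dvdm_imp_dvdm_pderiv[OF dvd] dvdm_mult_left[OF that]] by metis
    thus ?thesis by (simp add: irreducible_m_dvdm_mult[OF f])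
  qed
  ultimately show ?thesis by blast
qed

lemma irreducible_m_degree_pos:
  assumes "irreducible_m f" "lead_coeff f = 1"
  shows "degree f > 0"
proof (rule ccontr)
  assume "\<not> degree f > 0"
  hence "f = 1" using assms(2) by (metis degree_0_id gr0I pCons_one)
  thus False using assms(1) dvd_imp_dvdm[of 1 1] by (simp add: irreducible_m_def)
qed

text \<open>If \<open>f\<close> divided \<open>h\<close>, then \<open>f^2\<close> would divide
  \<open>g\<close>, and \<open>f\<close> would divide \<open>pderiv g\<close>. So whether
  \<open>f\<close> divides \<open>w\<close> or \<open>h\<close>, it divides both Bezout terms and
  hence the nonzero constant \<open>k\<close> modulo \<open>p\<close>, although its degree is
  positive.\<close>

lemma cofactor_not_dvdm:
  assumes f: "irreducible_m f" "lead_coeff f = 1"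
    and bezout: "a * g + w * c * pderiv g = [:k:]" and k: "\<not> p dvd k"
    and g: "g =m f * h"
  shows "\<not> f dvdm w * h^2"
proof
  assume "f dvdm w * h^2"
  hence "f dvdm w \<or> f dvdm h"
    by (simp add: power2_eq_square irreducible_m_dvdm_mult[OF f])
  hence "f dvdm w * c * pderiv g"
  proof
    assume "f dvdm w"
    thus ?thesis by (metis dvdm_factor)
  next
    assume "f dvdm h"
    then obtain j where "h =m f * j" by (auto simp: dvdm_def)
    hence "g =m f^2 * j" using g by (metis mult_Mp(2) mult.assoc power2_eq_square)
    hence "f dvdm pderiv g" using square_dvdm_imp_dvdm_pderiv by (auto simp: dvdm_def)
    thus ?thesis by (rule dvdm_mult_left)
  qed
  moreover have "f dvdm g" using g unfolding dvdm_def by blast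
  hence "f dvdm a * g" by (rule dvdm_mult_left)
  ultimately have "f dvdm [:k:]" unfolding bezout[symmetric] by (intro dvdm_add)
  thus False
    using monic_dvdm_constant irreducible_m_degree_pos[OF f] f(2) k by (auto simp: mod_eq_0_iff_dvd)
qed

text \<open>Linear Hensel lifting, one power of \<open>p\<close> per step: Bezout splits the error
  into corrections of the two factors. Only \<open>f'\<close> is kept monic of fixed degree.\<close>

lemma hensel_lift_factor:
  assumes f: "lead_coeff f = 1" "degree f > 0" and g: "g =m f * h"
    and bezout: "u * f + v * h =m 1"
  shows "\<exists>f' h' r. lead_coeff f' = 1 \<and> degree f' = degree f \<and> f' =m f \<and> h' =m h \<and>
    g = f' * h' + smult (p ^ Suc N) r"
proof (induction N)
  case 0
  show ?case using f g eq_m_iff[of g "f * h"] by auto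
next
  case (Suc N)
  then obtain f' h' r where f': "lead_coeff f' = 1" "degree f' = degree f" "f' =m f"
    and h': "h' =m h" and r: "g = f' * h' + smult (p ^ Suc N) r" by blast
  have "u * f' + v * h' =m u * f + v * h"
    using f'(3) h' by (intro eq_m_add eq_m_mult) auto
  hence "r * (u * f' + v * h') =m r * 1" using bezout by (intro eq_m_mult) auto
  then obtain e where e: "r = r * (u * f' + v * h') + smult p e"
    unfolding eq_m_iff by (metis eq_m_iff mult.right_neutral)
  \<comment> \<open>Reducing \<open>r * v\<close> modulo \<open>f'\<close> keeps the correction of
    \<open>f'\<close> below its degree, so the lift stays monic; \<open>b\<close> absorbs the
    quotient.\<close>
  obtain q a where a: "r * v = a + f' * q" "degree a < degree f'"
    using monic_divmod_ex[of f' "r * v"] f f' by metis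
  define b where "b = r * u + q * h'"
  define P where "P = p ^ Suc N"
  have r_eq: "r = a * h' + b * f' + smult p e"
  proof -
    have "r * (u * f' + v * h') = r * u * f' + (r * v) * h'" by (simp add: algebra_simps)
    also have "\<dots> = a * h' + b * f'" unfolding a(1) b_def by (simp add: algebra_simps)
    finally show ?thesis using e by simp
  qed
  define f'' h'' where "f'' = f' + smult P a" and "h'' = h' + smult P b"
  have deg: "degree (smult P a) < degree f'"
    using a(2) degree_smult_le le_less_trans by blast
  have P: "P = p * p ^ N" by (simp add: P_def)
  have f'': "lead_coeff f'' = 1" "degree f'' = degree f"
    using monic_smult_add_small[of a f' P] a(2) f' degree_add_eq_left[OF deg] unfolding f''_def
    by simp_all
  have "f'' =m f'" "h'' =m h'"
    unfolding f''_def h''_def P eq_m_iff smult_smult[symmetric] by blast+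
  hence "f'' =m f" "h'' =m h" using f'(3) h' by simp_all
  moreover have "g = f'' * h'' + smult (p ^ Suc (Suc N)) (e - smult (p ^ N) (a * b))"
  proof -
    have "g = f' * h' + [:P:] * (a * h' + b * f' + [:p:] * e)"
      using r r_eq by (simp add: P_def)
    also have "\<dots> = (f' + [:P:] * a) * (h' + [:P:] * b) + [:P * p:] * e - [:P:] * [:P:] * (a * b)"
      by (simp add: algebra_simps)
    \<comment> \<open>As \<open>P\<close> contains a factor \<open>p\<close>, the quadratic term
      joins the new error.\<close>
    also have "[:P:] * [:P:] * (a * b) = smult (P * p) (smult (p ^ N) (a * b))"
      by (simp add: P mult_ac)
    finally show ?thesis
      by (simp add: f''_def h''_def P_def smult_diff_right mult_ac)
  qed
  ultimately show ?case using f'' by blast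
qed

end

section \<open>Newton polygons\<close>

text \<open>Each division with remainder by the monic \<open>\<phi>\<close> reveals one coefficient,
  so a nested expression can be read off as a development.\<close>

lemma adic_development_step:
  fixes \<phi> :: "int poly"
  assumes m: "lead_coeff \<phi> = 1" and r: "degree r < degree \<phi>"
  shows "adic_development \<phi> (r + \<phi> * q) = case_nat r (adic_development \<phi> q)"
proof -
  have "degree \<phi> > 0" using r by simp
  note dev = is_adic_development_adic_development[OF m this]
  have "is_adic_development \<phi> (r + \<phi> * q) (case_nat r (adic_development \<phi> q))"
  proof -
    obtain n where n: "\<forall>j\<ge>n. adic_development \<phi> q j = 0"
      "q = (\<Sum>j<n. adic_development \<phi> q j * \<phi> ^ j)"
      using dev[of q] unfolding is_adic_development_upto by blast
    show ?thesis unfolding is_adic_development_upto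
    proof (intro conjI exI)
      show "\<forall>j. degree (case_nat r (adic_development \<phi> q) j) < degree \<phi>"
        using dev[of q] r unfolding is_adic_development_def by (auto split: nat.split)
      show "\<forall>j\<ge>Suc n. case_nat r (adic_development \<phi> q) j = 0"
        using n(1) by (auto split: nat.split)
      show "r + \<phi> * q = (\<Sum>j<Suc n. case_nat r (adic_development \<phi> q) j * \<phi> ^ j)"
        unfolding sum_adic_shift using n(2) by simp
    qed
  qed
  thus ?thesis using adic_development_unique[OF m dev] by blast
qed

lemma padic_val_ge_iff:
  assumes "prime p"
  shows "enat u \<le> padic_val p x \<longleftrightarrow> int p ^ u dvd x"
proof (cases "x = 0")
  case False
  have "\<not> is_unit (int p)" using assms by (auto simp: prime_nat_iff)
  thus ?thesis using False by (simp add: padic_val_def power_dvd_iff_le_multiplicity)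
qed (simp add: padic_val_def)

lemma poly_val_ge_iff:
  assumes "prime p"
  shows "enat u \<le> poly_val p a \<longleftrightarrow> (\<forall>i. int p ^ u dvd coeff a i)"
  by (simp add: poly_val_def le_INF_iff padic_val_ge_iff[OF assms])

lemma enat_eq_iff_le_not_Suc_le: "x = enat u \<longleftrightarrow> enat u \<le> x \<and> \<not> enat (Suc u) \<le> x"
  by (cases x) auto

section \<open>Sides of the lower convex hull\<close>

lemma lower_hull_le:
  assumes "(x, y) \<in> lower_hull P" "(x, y') \<in> convex hull P"
  shows "y \<le> y'"
  using assms by (auto simp: lower_hull_def)

lemma fst_le_of_mem_segment:
  fixes a b :: "real \<times> real"
  assumes "(x, y) \<in> closed_segment a b" "fst a \<le> fst b"
  shows "x \<le> fst b"
proof -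
  obtain ax ay bx "by" where ab: "a = (ax, ay)" "b = (bx, by)" by fastforce
  obtain u where "0 \<le> u" "u \<le> 1" "x = (1 - u) * ax + u * bx"
    using assms(1) by (auto simp: closed_segment_def ab)
  thus ?thesis using assms(2) convex_bound_le[of ax bx bx "1 - u" u] by (simp add: ab)
qed

text \<open>Since \<open>P\<close> lies on or above the axis and reaches it at
  \<open>(c, 0)\<close>, its lower boundary cannot descend to the right of \<open>c\<close>.\<close>

lemma descending_segment_left_of_zero:
  assumes nonneg: "\<And>x y. (x, y) \<in> P \<Longrightarrow> 0 \<le> (y::real)" and c: "(c::real, 0) \<in> P"
    and ab: "closed_segment a b \<subseteq> lower_hull P" "fst a < fst b" "snd b < snd a"
  shows "fst b \<le> c"
proof (rule ccontr)
  assume "\<not> fst b \<le> c"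
  obtain ax ay bx "by" where abd: "a = (ax, ay)" "b = (bx, by)" by fastforce
  have lt: "ax < bx" "by < ay" "c < bx" using ab \<open>\<not> fst b \<le> c\<close> by (auto simp: abd)
  have "convex hull P \<subseteq> {z. 0 \<le> snd z}"
    using nonneg convex_halfspace_ge[of "0::real" "(0::real, 1::real)"]
    by (intro hull_minimal) (auto simp: inner_prod_def)
  moreover have low: "a \<in> lower_hull P" "b \<in> lower_hull P" using ab(1) by auto
  hence hull: "b \<in> convex hull P" by (auto simp: lower_hull_def abd)
  ultimately have "by \<ge> 0" by (auto simp: abd)
  have chull: "(c, 0) \<in> convex hull P" using c by (rule hull_inc)
  show False
  proof (cases "ax < c")
    \<comment> \<open>The segment passes over \<open>c\<close> at positive height, although the hull
      contains \<open>(c, 0)\<close>.\<close>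
    case True
    define s where "s = (c - ax) / (bx - ax)"
    have s: "0 < s" "s < 1" using True lt by (auto simp: s_def)
    have "s * (bx - ax) = c - ax" using lt by (simp add: s_def)
    hence "(1 - s) * ax + s * bx = c" by (simp add: algebra_simps)
    hence "(c, (1 - s) * ay + s * by) \<in> closed_segment a b"
      using s by (auto simp: closed_segment_def abd intro!: exI[of _ s])
    hence "(1 - s) * ay + s * by \<le> 0" using ab(1) lower_hull_le[OF _ chull] by blast
    moreover have "(1 - s) * ay > 0" "s * by \<ge> 0" using s lt \<open>by \<ge> 0\<close> by simp_all
    ultimately show False by linarith
  next
    \<comment> \<open>The chord from \<open>(c, 0)\<close> to \<open>b\<close> lies in the hull and
      passes strictly below \<open>a\<close>.\<close>
    case False
    define s where "s = (ax - c) / (bx - c)"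
    have s: "0 \<le> s" "s \<le> 1" using False lt by (auto simp: s_def)
    have "s * (bx - c) = ax - c" using lt by (simp add: s_def)
    hence x: "(1 - s) * c + s * bx = ax" by (simp add: algebra_simps)
    have "(1 - s) *\<^sub>R (c, 0) + s *\<^sub>R b \<in> convex hull P"
      using s by (intro convexD[OF convex_convex_hull chull hull]) auto
    hence "(ax, s * by) \<in> convex hull P" using x by (simp add: abd)
    hence "ay \<le> s * by" using low(1) lower_hull_le by (simp add: abd)
    also have "\<dots> \<le> by" using s \<open>by \<ge> 0\<close> by (simp add: mult_left_le_one_le)
    finally show False using lt by simp
  qed
qed

text \<open>The line \<open>V * x + c * y = V * c\<close> supports the hull and meets it exactly in
  the segment, because the hull lies in the first quadrant. Any other descending side ends at or
  before \<open>c\<close>, so minimality puts it inside this segment.\<close>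

lemma principal_sides_single:
  fixes V c :: real
  assumes above: "\<And>x y. (x, y) \<in> newton_points p \<phi> f \<Longrightarrow> 0 \<le> x \<and> 0 \<le> y \<and> V * c \<le> V * x + c * y"
    and ends: "(0, V) \<in> newton_points p \<phi> f" "(c, 0) \<in> newton_points p \<phi> f"
    and pos: "V > 0" "c > 0"
  shows "principal_sides p \<phi> f = {closed_segment (0, V) (c, 0)}"
proof -
  define P where "P = newton_points p \<phi> f"
  define S where "S = closed_segment (0, V) (c, 0)"
  note above = above[folded P_def] and ends = ends[folded P_def]
  have half: "convex hull P \<subseteq> {z. b \<le> d \<bullet> z}" if "\<And>z. z \<in> P \<Longrightarrow> b \<le> d \<bullet> z" for b d
    using that by (intro hull_minimal convex_halfspace_ge) auto
  have hullD: "0 \<le> x \<and> 0 \<le> y \<and> V * c \<le> V * x + c * y" if "(x, y) \<in> convex hull P" for x y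
    using that half[of 0 "(1, 0)"] half[of 0 "(0, 1)"] half[of "V * c" "(V, c)"] above
    by (force simp: inner_prod_def)
  have S_hull: "S \<subseteq> convex hull P"
    unfolding S_def using ends by (intro closed_segment_subset) (auto intro: hull_inc)
  have S_iff: "(x, y) \<in> S \<longleftrightarrow> 0 \<le> x \<and> 0 \<le> y \<and> V * x + c * y = V * c" for x y
  proof
    assume "(x, y) \<in> S"
    then obtain u where u: "0 \<le> u" "u \<le> 1" "x = u * c" "y = (1 - u) * V"
      by (auto simp: S_def closed_segment_def)
    hence "0 \<le> x" "0 \<le> y" using pos by simp_all
    moreover have "V * x + c * y = V * c" unfolding u by (simp add: algebra_simps)
    ultimately show "0 \<le> x \<and> 0 \<le> y \<and> V * x + c * y = V * c" by blast
  next
    assume *: "0 \<le> x \<and> 0 \<le> y \<and> V * x + c * y = V * c"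
    define u where "u = x / c"
    have "0 \<le> u" using * pos by (simp add: u_def)
    moreover have "V * x \<le> V * c" using * pos by (smt (verit) mult_nonneg_nonneg)
    hence "u \<le> 1" using pos by (simp add: u_def)
    moreover have x: "x = u * c" using pos by (simp add: u_def)
    moreover have "c * y = c * ((1 - u) * V)" using * x by (simp add: algebra_simps)
    hence "y = (1 - u) * V" using pos by simp
    ultimately show "(x, y) \<in> S" by (auto simp: S_def closed_segment_def intro!: exI[of _ u])
  qed
  have "convex hull P \<inter> {z. (V, c) \<bullet> z = V * c} = S"
    using S_hull S_iff hullD by (fastforce simp: inner_prod_def)
  moreover have "(convex hull P \<inter> {z. (V, c) \<bullet> z = V * c}) face_of (convex hull P)"
    by (rule face_of_Int_supporting_hyperplane_ge) (use hullD in \<open>auto simp: inner_prod_def\<close>)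
  ultimately have S_face: "S face_of (convex hull P)" by simp
  have S_dim: "aff_dim S = 1"
    unfolding S_def segment_convex_hull aff_dim_convex_hull using pos by (simp add: aff_dim_2)
  have S_low: "S \<subseteq> lower_hull P"
  proof (rule subrelI)
    fix x y assume xy: "(x, y) \<in> S"
    have "y \<le> y'" if "(x, y') \<in> convex hull P" for y'
    proof -
      have "c * y \<le> c * y'" using hullD[OF that] xy by (simp add: S_iff)
      thus ?thesis using pos by simp
    qed
    thus "(x, y) \<in> lower_hull P" using S_hull xy by (auto simp: lower_hull_def)
  qed
  have unique: "closed_segment a b = S"
    if ab: "closed_segment a b edge_of (convex hull P)" "closed_segment a b \<subseteq> lower_hull P"
      "fst a < fst b" "snd b < snd a" for a b
  proof -
    have bc: "fst b \<le> c"
      by (rule descending_segment_left_of_zero[OF _ ends(2) ab(2-)]) (use above in auto)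
    have "closed_segment a b \<subseteq> S"
    proof (rule subrelI)
      fix x y assume xy: "(x, y) \<in> closed_segment a b"
      hence low: "(x, y) \<in> lower_hull P" using ab(2) by blast
      hence h: "0 \<le> x" "0 \<le> y" "V * c \<le> V * x + c * y"
        using hullD by (auto simp: lower_hull_def)
      have "x \<le> c" using fst_le_of_mem_segment[OF xy] ab(3) bc by simp
      \<comment> \<open>The height of \<open>S\<close> over \<open>x\<close>.\<close>
      define y' where "y' = V * (c - x) / c"
      have "c * y' = V * (c - x)" using pos by (simp add: y'_def)
      hence y': "V * x + c * y' = V * c" by (simp add: algebra_simps)
      moreover have "y' \<ge> 0" using pos \<open>x \<le> c\<close> by (simp add: y'_def)
      ultimately have "(x, y') \<in> S" using h(1) S_iff by blast
      hence "y \<le> y'" using lower_hull_le[OF low] S_hull by blast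
      hence "c * y \<le> c * y'" using pos by simp
      thus "(x, y) \<in> S" unfolding S_iff using h y' by simp
    qed
    hence face: "closed_segment a b face_of S"
      using ab(1) S_hull by (auto simp: edge_of_def intro: face_of_subset)
    have "\<not> aff_dim (closed_segment a b) < aff_dim S"
      using ab(1) S_dim by (simp add: edge_of_def)
    \<comment> \<open>A proper face of a convex set has smaller dimension, but both segments have
      dimension 1.\<close>
    thus ?thesis
      using face_of_aff_dim_lt[OF _ face] by (metis S_def convex_closed_segment)
  qed
  have S_edge: "S edge_of (convex hull P)" using S_face S_dim by (simp add: edge_of_def)
  show ?thesis
    unfolding principal_sides_def P_def[symmetric] S_def[symmetric]
  proof (intro equalityI subsetI)
    fix X assume "X \<in> {S}"
    hence "X = closed_segment (0, V) (c, 0)" by (simp add: S_def)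
    moreover have "fst (0::real, V) < fst (c, 0::real)" "snd (c, 0::real) < snd (0::real, V)"
      using pos by simp_all
    ultimately show "X \<in> {closed_segment a b | a b. closed_segment a b edge_of (convex hull P) \<and>
        closed_segment a b \<subseteq> lower_hull P \<and> fst a < fst b \<and> snd b < snd a}"
      using S_edge S_low unfolding S_def by blast
  qed (use unique in blast)
qed

text \<open>Over 2 the side has height 0, so only the abscissa 1 contributes, where the height is
  \<open>V / 2\<close>.\<close>

lemma phi_index_single_side:
  assumes sides: "principal_sides p \<phi> f = {closed_segment (0, real V) (2, 0)}"
  shows "phi_index p \<phi> f = degree \<phi> * (V div 2)"
proof -
  have mem: "(x, y) \<in> principal_polygon p \<phi> f \<longleftrightarrow> 0 \<le> x \<and> x \<le> 2 \<and> y = real V * (1 - x / 2)"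
    for x y
  proof -
    have "(x, y) \<in> closed_segment (0, real V) (2, 0)
        \<longleftrightarrow> (\<exists>u. 0 \<le> u \<and> u \<le> 1 \<and> x = 2 * u \<and> y = (1 - u) * real V)"
      by (auto simp: closed_segment_def)
    also have "\<dots> \<longleftrightarrow> 0 \<le> x \<and> x \<le> 2 \<and> y = real V * (1 - x / 2)"
      by (auto intro!: exI[of _ "x / 2"])
    finally show ?thesis by (simp add: principal_polygon_def sides)
  qed
  have "{(i::int, j::int). 0 < i \<and> 0 < j \<and>
      (\<exists>y. (real_of_int i, y) \<in> principal_polygon p \<phi> f \<and> real_of_int j \<le> y)}
      = {1} \<times> {1..int (V div 2)}" (is "?L = ?R")
  proof (intro equalityI subsetI)
    fix z assume "z \<in> ?L"
    then obtain i j where z: "z = (i, j)" and i: "0 < i" "i \<le> 2" and j: "0 < j"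
      and le: "real_of_int j \<le> real V * (1 - real_of_int i / 2)"
      by (auto simp: mem)
    have "i \<noteq> 2" using le j by auto
    hence "i = 1" using i by simp
    hence "real_of_int (2 * j) \<le> real_of_int (int V)" using le by simp
    hence "2 * j \<le> int V" by (simp only: of_int_le_iff)
    thus "z \<in> ?R" using z \<open>i = 1\<close> j by auto
  next
    fix z assume "z \<in> ?R"
    then obtain j where z: "z = (1, j)" "1 \<le> j" "j \<le> int (V div 2)" by auto
    hence "2 * j \<le> int V" by auto
    hence "real_of_int (2 * j) \<le> real_of_int (int V)" by (simp only: of_int_le_iff)
    thus "z \<in> ?L" using z by (auto simp: mem)
  qed
  thus ?thesis by (simp add: phi_index_def card_cartesian_product)
qed

text \<open>The point \<open>(1, 0)\<close> stops the principal polygon at abscissa 1 and bounds its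
  height there by 0, whether or not it has any side.\<close>

lemma phi_index_eq_0:
  assumes "poly_val p (adic_development \<phi> f 1) = 0"
  shows "phi_index p \<phi> f = 0"
proof -
  define P where "P = newton_points p \<phi> f"
  have one: "(1, 0) \<in> P"
    unfolding P_def newton_points_def using assms
    by (auto simp: zero_enat_def intro!: exI[of _ "1::nat"] exI[of _ "0::nat"])
  have nonneg: "0 \<le> y" if "(x, y) \<in> P" for x y
    using that by (auto simp: P_def newton_points_def)
  have "y \<le> 0" if i: "0 < i" and mem: "(real_of_int i, y) \<in> principal_polygon p \<phi> f" for i y
  proof -
    obtain a b where ab: "closed_segment a b \<subseteq> lower_hull P" "fst a < fst b" "snd b < snd a"
      and in_ab: "(real_of_int i, y) \<in> closed_segment a b"
      using mem by (auto simp: principal_polygon_def principal_sides_def P_def)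
    have "real_of_int i \<le> fst b" using fst_le_of_mem_segment[OF in_ab] ab(2) by simp
    also have "\<dots> \<le> 1" using descending_segment_left_of_zero[OF nonneg one ab] .
    finally have "i = 1" using i by simp
    moreover have "(1, 0) \<in> convex hull P" using one by (rule hull_inc)
    ultimately show ?thesis using in_ab ab(1) lower_hull_le[of 1 y P 0] by auto
  qed
  hence empty: "{(i::int, j::int). 0 < i \<and> 0 < j \<and>
      (\<exists>y. (real_of_int i, y) \<in> principal_polygon p \<phi> f \<and> real_of_int j \<le> y)} = {}"
    by force
  show ?thesis unfolding phi_index_def empty by simp
qed

section \<open>Valuations of the leading terms of a development\<close>

text \<open>The term with \<open>p^N\<close> changes every coefficient by a multiple of
  \<open>p^N\<close> only, and \<open>N > V\<close>. The coefficient at 2 is the remainder of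
  \<open>B\<close> modulo \<open>\<phi>\<close> up to multiples of \<open>p\<close>, and it does not
  vanish modulo \<open>p\<close>.\<close>

lemma poly_val_development:
  fixes \<phi> B K :: "int poly"
  assumes p: "prime p" and \<phi>: "lead_coeff \<phi> = 1" "degree \<phi> > 0"
    and f: "f = B * \<phi>^2 + [:int p ^ N:] * K - [:c:]"
    and c: "padic_val p c = enat V" and VN: "V < N"
    and B: "\<not> poly_mod.dvdm (int p) \<phi> B"
  shows "poly_val p (adic_development \<phi> f 0) = enat V"
    and "enat N \<le> poly_val p (adic_development \<phi> f 1)"
    and "poly_val p (adic_development \<phi> f 2) = 0"
proof -
  define q where "q = int p ^ N"
  \<comment> \<open>Two divisions split off the contributions of \<open>K\<close> to the first two
    coefficients; the rest is a multiple of \<open>\<phi>^2\<close> and joins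
    \<open>B\<close>.\<close>
  obtain K' k0 where K: "K = k0 + \<phi> * K'" and k0: "degree k0 < degree \<phi>"
    using monic_divmod_ex[OF \<phi>] by metis
  obtain k2 k1 where K': "K' = k1 + \<phi> * k2" and k1: "degree k1 < degree \<phi>"
    using monic_divmod_ex[OF \<phi>] by metis
  obtain b' b where b: "B + [:q:] * k2 = b + \<phi> * b'" "degree b < degree \<phi>"
    using monic_divmod_ex[OF \<phi>] by metis
  have f': "f = ([:q:] * k0 - [:c:]) + \<phi> * ([:q:] * k1 + \<phi> * (b + \<phi> * b'))"
    unfolding b(1)[symmetric] f K K' q_def[symmetric]
    by (simp only: algebra_simps power2_eq_square)
  have deg: "degree ([:q:] * k0 - [:c:]) < degree \<phi>" "degree ([:q:] * k1) < degree \<phi>"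
    using k0 k1 \<phi>(2) by (auto intro!: degree_diff_less le_less_trans[OF degree_smult_le])
  have a: "adic_development \<phi> f 0 = [:q:] * k0 - [:c:]"
    "adic_development \<phi> f 1 = [:q:] * k1" "adic_development \<phi> f 2 = b"
    unfolding f' by (simp_all add: adic_development_step[OF \<phi>(1)] deg b(2) numeral_2_eq_2
        del: mult_pCons_left)
  have cV: "int p ^ V dvd c" "\<not> int p ^ Suc V dvd c"
    using c unfolding enat_eq_iff_le_not_Suc_le padic_val_ge_iff[OF p] by auto
  have qV: "int p ^ V dvd q" "int p ^ Suc V dvd q"
    unfolding q_def using VN by (auto intro!: le_imp_power_dvd simp del: power_Suc)
  have "int p ^ V dvd coeff ([:q:] * k0 - [:c:]) i" for i
    using cV qV by (cases i) auto
  \<comment> \<open>The valuation \<open>V\<close> is attained at the constant coefficient, the one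
    affected by \<open>c\<close>.\<close>
  moreover have "\<not> int p ^ Suc V dvd coeff ([:q:] * k0 - [:c:]) 0"
    using cV qV by (simp add: dvd_diff_right_iff del: power_Suc)
  ultimately show "poly_val p (adic_development \<phi> f 0) = enat V"
    unfolding a enat_eq_iff_le_not_Suc_le poly_val_ge_iff[OF p] by blast
  show "enat N \<le> poly_val p (adic_development \<phi> f 1)"
    unfolding a poly_val_ge_iff[OF p] by (simp add: q_def)
  show "poly_val p (adic_development \<phi> f 2) = 0"
  proof (rule ccontr)
    assume "poly_val p (adic_development \<phi> f 2) \<noteq> 0"
    hence "enat 1 \<le> poly_val p b" unfolding a by (metis ileI1 i0_lb order_le_less one_eSuc one_enat_def)
    hence "\<forall>i. int p dvd coeff b i" unfolding poly_val_ge_iff[OF p] by simp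
    then obtain b1 where b1: "b = [:int p:] * b1"
      using const_poly_dvd_iff[of "int p" b] by (auto simp: dvd_def)
    have "q = int p * int p ^ (N - 1)" using VN by (simp add: q_def flip: power_Suc)
    hence "[:q:] * k2 = [:int p:] * ([:int p ^ (N - 1):] * k2)" by (simp add: mult.commute)
    hence "B = b' * \<phi> + [:int p:] * (b1 - [:int p ^ (N - 1):] * k2)"
      using b(1) unfolding b1 by (simp only: algebra_simps)
    hence "B = b' * \<phi> + smult (int p) (b1 - [:int p ^ (N - 1):] * k2)" by simp
    thus False using B poly_mod.div_mod_imp_dvdm by blast
  qed
qed

text \<open>From abscissa 2 on, the line through \<open>(0, V)\<close> and \<open>(2, 0)\<close> is
  not above the axis, so three coefficients decide everything.\<close>

lemma principal_sides_of_poly_val: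
  assumes "poly_val p (adic_development \<phi> f 0) = enat V"
    and "enat V \<le> poly_val p (adic_development \<phi> f 1)"
    and "poly_val p (adic_development \<phi> f 2) = 0" and "V > 0"
  shows "principal_sides p \<phi> f = {closed_segment (0, real V) (2, 0)}"
proof (rule principal_sides_single)
  fix x y assume "(x, y) \<in> newton_points p \<phi> f"
  then obtain j u where xy: "x = real j" "y = real u"
    and u: "poly_val p (adic_development \<phi> f j) = enat u"
    by (auto simp: newton_points_def)
  have "V * 2 \<le> V * j + 2 * u"
  proof (cases "j < 2")
    case True
    hence "j = 0 \<or> j = 1" by auto
    thus ?thesis using assms(1,2) u by auto
  next
    case False
    thus ?thesis by (simp add: add_increasing2)
  qed
  hence "real (V * 2) \<le> real (V * j + 2 * u)" by (simp only: of_nat_le_iff)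
  thus "0 \<le> x \<and> 0 \<le> y \<and> real V * 2 \<le> real V * x + 2 * y" using xy by simp
next
  show "(0, real V) \<in> newton_points p \<phi> f"
    using assms(1) by (auto simp: newton_points_def intro!: exI[of _ "0::nat"])
  show "(2, 0) \<in> newton_points p \<phi> f"
    using assms(3) by (auto simp: newton_points_def zero_enat_def intro!: exI[of _ "2::nat"])
qed (use assms(4) in auto)

text \<open>The coefficient in question is the remainder of \<open>g\<close> modulo
  \<open>[:- e, 1:]\<close>, that is, \<open>poly g e\<close>.\<close>

lemma poly_val_linear_development_1:
  assumes p: "prime p" and g: "\<not> int p dvd poly g e"
  shows "poly_val p (adic_development [:- e, 1:] ([:- e, 1:] * g - [:c:]) 1) = 0"
proof -
  let ?w = "[:- e, 1:]"
  obtain q r where qr: "g = r + ?w * q" "degree r < degree ?w"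
    by (rule monic_divmod_ex[of ?w g, OF _ _ that]) simp_all
  then obtain d where d: "r = [:d:]" by (auto elim: degree_eq_zeroE)
  have "poly g e = d" unfolding qr(1) d by simp
  have f: "?w * g - [:c:] = [:- c:] + ?w * ([:d:] + ?w * q)"
    unfolding qr(1) d by simp
  have dev: "adic_development ?w (?w * g - [:c:]) 1 = [:d:]"
    unfolding f by (simp add: adic_development_step del: mult_pCons_left)
  have "\<not> enat 1 \<le> poly_val p [:d:]"
    using g \<open>poly g e = d\<close> unfolding poly_val_ge_iff[OF p] by (auto intro!: exI[of _ 0])
  thus ?thesis unfolding dev by (metis i0_lb ileI1 one_eSuc one_enat_def order_le_less)
qed

section \<open>Newton polygons of the shifted iterate\<close>

theorem theorem6p1:
  fixes l n p r :: nat and t \<epsilon> :: int and \<Phi> :: "int poly" and \<phi> :: "nat \<Rightarrow> int poly"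
  assumes "prime l" and "odd l" and "n > 0"
    and "\<Phi> = poly_iterate (chebyshev l) n - [:t:]"
    and "prime p" and "odd p" and "p \<noteq> l"
    and "\<epsilon> \<in> {2, -2}" and "[t = \<epsilon>] (mod (int p)^2)"
    and "\<And>i. i \<in> {1..r} \<Longrightarrow> lead_coeff (\<phi> i) = 1"
    and "\<And>i. i \<in> {1..r} \<Longrightarrow> poly_mod.irreducible_m (int p) (\<phi> i)"
    and "poly_mod.Mp (int p) \<Phi> = poly_mod.Mp (int p) ([:- \<epsilon>, 1:] * (\<Prod>i=1..r. (\<phi> i)^2))"
  shows "(\<forall>V. padic_val p (t^2 - 4) = enat V \<longrightarrow>
            (\<forall>i\<in>{1..r}. \<exists>\<phi>'.
               lead_coeff \<phi>' = 1 \<and>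
               poly_mod.Mp (int p) \<phi>' = poly_mod.Mp (int p) (\<phi> i) \<and>
               principal_sides p \<phi>' \<Phi> = {closed_segment (0, real V) (2, 0)} \<and>
               int (phi_index p \<phi>' \<Phi>) = \<lfloor>real V / 2\<rfloor> * int (degree \<phi>')))
         \<and> phi_index p [:- \<epsilon>, 1:] \<Phi> = 0"
proof -
  define D where "D = l ^ n"
  have "odd D" using assms(2) by (simp add: D_def)
  then obtain m where m: "D = 2 * m + 1" by (rule oddE)
  obtain s where s: "\<epsilon> = 2 * s" "s^2 = 1" using assms(8) by (auto simp: power2_eq_square)
  define G w k where "G = cheb_root s m" and "w = [:- \<epsilon>, 1:]" and "k = 4 * s * int D ^ 2"
  have T: "is_chebyshev (2 * m + 1) (poly_iterate (chebyshev l) n)"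
    using is_chebyshev_iterate[OF is_chebyshev_chebyshev] prime_gt_0_nat[OF assms(1)]
    by (metis D_def m)
  have \<Phi>: "\<Phi> = w * G^2 - [:t - \<epsilon>:]"
    unfolding assms(4) chebyshev_eq_square[OF T s(2)] by (simp add: G_def w_def s(1))
  obtain a c where bezout: "a * G + w * c * pderiv G = [:k:]"
    using cheb_root_bezout[OF T s(2)] unfolding G_def w_def k_def m s(1) by metis
  interpret poly_mod_prime "int p" by unfold_locales (use assms(5) in simp)
  \<comment> \<open>Up to sign \<open>k\<close> is \<open>4 * D^2\<close>, whose prime factors are 2
    and \<open>l\<close>, both different from \<open>p\<close>.\<close>
  have p_dvd_2: "\<not> int p dvd 2"
    using assms(5,6) by (metis int_dvd_int_iff of_nat_numeral primes_dvd_imp_eq two_is_prime_nat even_numeral)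
  have "\<not> int p dvd int D"
    using assms(1,5,7) prime_dvd_power primes_dvd_imp_eq unfolding D_def int_dvd_int_iff by blast
  moreover have "s dvd 1" using s(2) by (metis dvd_triv_left power2_eq_square)
  hence "\<not> int p dvd s" using prime by (metis dvd_trans not_prime_unit)
  moreover have "k = 2 * 2 * s * (int D * int D)" by (simp add: k_def power2_eq_square)
  ultimately have k: "\<not> int p dvd k"
    using p_dvd_2 by (simp only: prime_dvd_mult_iff[OF prime]) blast
  have tp: "int p ^ 2 dvd t - \<epsilon>" using assms(9) by (simp add: cong_iff_dvd_diff)
  hence tp1: "int p dvd t - \<epsilon>" by (metis dvd_trans dvd_triv_left power2_eq_square)
  have index_0: "phi_index p w \<Phi> = 0"
  proof (rule phi_index_eq_0)
    \<comment> \<open>At \<open>\<epsilon>\<close> the second Bezout term vanishes with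
      \<open>w\<close>, so \<open>poly G \<epsilon>\<close> divides \<open>k\<close>.\<close>
    have "poly a \<epsilon> * poly G \<epsilon> = k"
      using arg_cong[OF bezout, of "\<lambda>f. poly f \<epsilon>"] by (simp add: w_def)
    hence "\<not> int p dvd poly (G^2) \<epsilon>"
      using k prime_dvd_power[OF prime] by (metis dvd_mult poly_power)
    thus "poly_val p (adic_development w \<Phi> 1) = 0"
      unfolding \<Phi> w_def by (rule poly_val_linear_development_1[OF assms(5)])
  qed
  have "\<exists>\<phi>'. lead_coeff \<phi>' = 1 \<and> \<phi>' =m \<phi> i \<and>
      principal_sides p \<phi>' \<Phi> = {closed_segment (0, real V) (2, 0)} \<and>
      int (phi_index p \<phi>' \<Phi>) = \<lfloor>real V / 2\<rfloor> * int (degree \<phi>')"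
    if V: "padic_val p (t^2 - 4) = enat V" and i: "i \<in> {1..r}" for V i
  proof -
    have irr: "irreducible_m (\<phi> i)" "lead_coeff (\<phi> i) = 1" using assms(10,11) i by auto
    \<comment> \<open>In \<open>t^2 - 4 = (t - \<epsilon>) * (t + \<epsilon>)\<close> the last
      factor is congruent to \<open>2 * \<epsilon>\<close>, a unit modulo \<open>p\<close>; so
      \<open>V\<close> is also the valuation of \<open>t - \<epsilon>\<close>.\<close>
    have "\<not> int p dvd 2 * \<epsilon>"
      using p_dvd_2 assms(8) prime_dvd_mult_iff[OF prime] by auto
    moreover have "t + \<epsilon> = (t - \<epsilon>) + 2 * \<epsilon>" by simp
    ultimately have "\<not> int p dvd t + \<epsilon>" using tp1 by (metis dvd_add_right_iff)
    hence "Rings.coprime (int p ^ u) (t + \<epsilon>)" for u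
      using prime_imp_coprime[OF prime] by simp
    moreover have "t^2 - 4 = (t - \<epsilon>) * (t + \<epsilon>)"
      using assms(8) by (auto simp: power2_eq_square algebra_simps)
    ultimately have "int p ^ u dvd t^2 - 4 \<longleftrightarrow> int p ^ u dvd t - \<epsilon>" for u
      by (simp add: coprime_dvd_mult_left_iff)
    hence tV: "padic_val p (t - \<epsilon>) = enat V"
      using V unfolding enat_eq_iff_le_not_Suc_le padic_val_ge_iff[OF assms(5)] by blast
    have "enat 2 \<le> enat V" unfolding tV[symmetric] padic_val_ge_iff[OF assms(5)] by (rule tp)
    hence V0: "V > 0" by simp
    obtain d where d: "t - \<epsilon> = int p * d" using tp1 by (auto simp: dvd_def)
    have "w * G^2 = \<Phi> + smult (int p) [:d:]" unfolding \<Phi> d by simp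
    hence "w * G^2 =m \<Phi>" using eq_m_iff by blast
    moreover have "\<phi> i ^ 2 dvd w * (\<Prod>i=1..r. (\<phi> i)^2)"
      using i by (intro dvd_mult dvd_prodI) auto
    ultimately have "\<phi> i ^ 2 dvdm w * G^2"
      using assms(12) dvd_imp_dvdm dvdm_cong unfolding w_def by metis
    moreover have "pderiv w = 1" by (simp add: w_def pderiv_pCons)
    ultimately have "\<phi> i dvdm G" using irreducible_m_dvdm_of_square[OF irr] by blast
    then obtain h where h: "G =m \<phi> i * h" by (auto simp: dvdm_def)
    have "\<not> \<phi> i dvdm w * h^2" using cofactor_not_dvdm[OF irr bezout k h] .
    hence "\<not> \<phi> i dvdm h" using dvdm_mult_left by (metis mult.assoc power2_eq_square)
    then obtain u v where "u * \<phi> i + v * h =m 1" using irreducible_m_bezout[OF irr] by blast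
    \<comment> \<open>Precision \<open>p^(V+1)\<close> keeps the lifting error from disturbing the
      valuation \<open>V\<close>. From here on \<open>r\<close> is the error polynomial, not the
      number of factors.\<close>
    then obtain f' h' r where f': "lead_coeff f' = 1" "f' =m \<phi> i"
      and G: "G = f' * h' + smult (int p ^ Suc V) r"
      using hensel_lift_factor[OF irr(2) irreducible_m_degree_pos[OF irr] h] by blast
    \<comment> \<open>The nondivisibility is derived afresh for \<open>f'\<close> and
      \<open>h'\<close>, the factors that occur in the development.\<close>
    have irr': "irreducible_m f'" using eq_m_irreducible_m[OF f'(2)] irr(1) by simp
    have "G = f' * h' + smult (int p) (smult (int p ^ V) r)"
      using G by simp
    hence "G =m f' * h'" using eq_m_iff by blast
    hence nd: "\<not> f' dvdm w * h'^2" using cofactor_not_dvdm[OF irr' f'(1) bezout k] by blast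
    define q where "q = [:int p ^ Suc V:]"
    have G': "G = f' * h' + q * r" using G by (simp add: q_def)
    \<comment> \<open>Squaring leaves an error divisible by \<open>q\<close>, so
      \<open>\<Phi>\<close> takes the shape of \<open>poly_val_development\<close> with
      \<open>w * h'^2\<close> for \<open>B\<close>.\<close>
    have alg: "w * (x + q * y)^2 = w * x^2 + q * (w * (2 * x * y + q * y^2))" for x y
      by (simp add: algebra_simps power2_eq_square)
    have "\<Phi> = w * h'^2 * f'^2 + q * (w * (2 * (f' * h') * r + q * r^2)) - [:t - \<epsilon>:]"
      by (simp only: \<Phi> G' alg) (simp only: power_mult_distrib mult_ac)
    note dev = poly_val_development[OF assms(5) f'(1) irreducible_m_degree_pos[OF irr' f'(1)]
        this[unfolded q_def] tV lessI nd]
    have "enat V \<le> poly_val p (adic_development f' \<Phi> 1)"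
      using dev(2) order_trans[of "enat V" "enat (Suc V)"] by simp
    hence sides: "principal_sides p f' \<Phi> = {closed_segment (0, real V) (2, 0)}"
      using principal_sides_of_poly_val[OF dev(1) _ dev(3) V0] by blast
    moreover have "\<lfloor>real V / 2\<rfloor> = int (V div 2)"
      using floor_divide_of_nat_eq[of V 2] by simp
    ultimately show ?thesis
      using f' phi_index_single_side[OF sides] by (auto intro!: exI[of _ f'])
  qed
  thus ?thesis using index_0 unfolding w_def by blast
qed

end
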